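(* Let $u_1,u_2,u_3,\ldots$ be independent, identically distributed real random variables such that $u_i\neq 0$ almost surely and $$E(u_i^4),\ E(u_i^8),\ E\big(\tfrac{1}{u_i^4}\big),\ E\big(\tfrac{1}{u_i^8}\big)<\infty .$$ For each integer $n\in\{3,4,5,\ldots\}$, let $M=M^{(n)}$ be the random $n\times n$ unistochastic matrix constructed from $u_1,\ldots,u_n$ with permutation matrix $Q=I$ (that is, $M$ is obtained by squaring the entries of the Householder matrix of $\vec u/|\vec u|$, $\vec u=(u_1,\ldots,u_n)^T$). Then $$E(\| M-I \|_F)\rightarrow 0 \quad\text{as } n\rightarrow\infty .$$ Moreover, for every $n\in\{3,4,5,\ldots\}$, $$E(\| M-I \|_F^2)\leq \frac{16n}{(n-1)^4}\,E\big(\tfrac{1}{u_i^8}\big)E(u_i^8)+\frac{16n}{(n-1)^2}\,E\big(\tfrac{1}{u_i^4}\big)E(u_i^4)+\frac{16n(n-1)}{(n-2)^4}\,E\big(\tfrac{1}{u_i^8}\big)\big(E(u_i^4)\big)^2 .$$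
   Context: Construction of $M$: given real random variables $u_1,\ldots,u_n$, not all zero almost surely, put $\vec u=(u_1,\ldots,u_n)^T$, $\vec v=\vec u/|\vec u|$ (Euclidean norm), and let $H=(h_{ij})=I-2\vec v\vec v^T$ be the corresponding Householder matrix. For an $n\times n$ permutation matrix $Q$ set $U=QH=(u_{ij})$ and define $M=(m_{ij})$ by $m_{ij}=u_{ij}^2$ (the square of the $(i,j)$ entry of $U$). When $Q=I$ this means $m_{ij}=h_{ij}^2$, i.e. $m_{ii}=\big(1-\tfrac{2u_i^2}{u_1^2+\cdots+u_n^2}\big)^2$ and $m_{ij}=\tfrac{4u_i^2u_j^2}{(u_1^2+\cdots+u_n^2)^2}$ for $i\neq j$. $\|\cdot\|_F$ is the Frobenius norm, $I$ the $n\times n$ identity matrix, and $E$ denotes expectation. Since the $u_i$ are identically distributed, the moments $E(u_i^4)$ etc. do not depend on $i$. *)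

theory Defs
  imports "HOL-Probability.Probability" "Jordan_Normal_Form.Matrix"
begin

no_notation vec_nth (infixl \<open>$\<close> 90)
no_notation inner (infix \<open>\<bullet>\<close> 70)

definition euclidean_norm_vec :: "real vec \<Rightarrow> real" where
  "euclidean_norm_vec x = sqrt (x \<bullet> x)"

definition outer_prod :: "real vec \<Rightarrow> real vec \<Rightarrow> real mat" where
  "outer_prod v w = mat (dim_vec v) (dim_vec w) (\<lambda>(i, j). v $ i * w $ j)"

definition householder_mat :: "real vec \<Rightarrow> real mat" where
  "householder_mat v = 1\<^sub>m (dim_vec v) - 2 \<cdot>\<^sub>m outer_prod v v"

(* For x = 0, division by zero makes the normalised vector 0 and the result is the
   entrywise square of Q; this is irrelevant for a random x that is nonzero almost surely.
   Q is meant to be a permutation matrix of size dim_vec x, for instance the identity. *)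
definition unistochastic_mat :: "real mat \<Rightarrow> real vec \<Rightarrow> real mat" where
  "unistochastic_mat Q x =
    (let v = (1 / euclidean_norm_vec x) \<cdot>\<^sub>v x;
         U = Q * householder_mat v
     in map_mat (\<lambda>a. a\<^sup>2) U)"

definition frobenius_norm :: "real mat \<Rightarrow> real" where
  "frobenius_norm A = sqrt (sum_mat (map_mat (\<lambda>a. a\<^sup>2) A))"

(* The sequence u is indexed from 0, so u 0, ..., u (n - 1) are the first n variables. *)
definition random_unistochastic_mat :: "(nat \<Rightarrow> 'a \<Rightarrow> real) \<Rightarrow> nat \<Rightarrow> 'a \<Rightarrow> real mat" where
  "random_unistochastic_mat u n \<omega> = unistochastic_mat (1\<^sub>m n) (vec n (\<lambda>i. u i \<omega>))"

end

theory Submission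
  imports Defs "HOL-Real_Asymp.Real_Asymp"
begin

text \<open>
  With \<open>S = u\<^sub>1\<^sup>2 + \<dots> + u\<^sub>n\<^sup>2\<close> and \<open>p = u\<^sub>i\<^sup>2 / S\<close>, the diagonal entries of
  \<open>M - I\<close> are \<open>(1 - 2p)\<^sup>2 - 1 = 4p\<^sup>2 - 4p\<close> and the others are \<open>4 u\<^sub>i\<^sup>2 u\<^sub>j\<^sup>2 / S\<^sup>2\<close>.
  Since \<open>p \<ge> 0\<close>, the squared Frobenius norm is at most 16 times a sum of \<open>n\<close> terms
  \<open>u\<^sub>i\<^sup>8 / S\<^sup>4\<close>, \<open>n\<close> terms \<open>u\<^sub>i\<^sup>4 / S\<^sup>2\<close> and \<open>n (n - 1)\<close> terms
  \<open>u\<^sub>i\<^sup>4 u\<^sub>j\<^sup>4 / S\<^sup>4\<close> (lemma \<open>frobenius_norm_unistochastic_mat_minus_one_le\<close>).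

  In each such term the numerator is not independent of \<open>S\<close>. Deleting from \<open>S\<close> the summands that
  occur in the numerator only increases the term and makes numerator and denominator independent; this
  leaves \<open>n - 1\<close> or \<open>n - 2\<close> summands. A power mean inequality then replaces the negative power
  of the remaining sum by an average of negative powers of the single summands, so that every
  expectation factorises into moments of one variable (lemmas \<open>inverse_power_sum_le\<close> and
  \<open>expectation_prod_div_sum_squares\<close>). Adding up gives the bound on the second moment, which is of
  order at most \<open>1 / n\<close>; the first moment is at most the square root of the second, so it tends to 0.
\<close>

section \<open>Moments of quotients by sums of squares\<close>

text \<open>
  Jensen's inequality for \<open>t \<mapsto> t\<^bsup>-k\<^esup>\<close> at the arithmetic mean of the \<open>x j\<close>, obtained in two steps
  from the convexity of \<open>t \<mapsto> 1 / t\<close> and of \<open>t \<mapsto> t\<^bsup>k\<^esup>\<close>. The factor \<open>card J ^ Suc k\<close> comes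
  from the \<open>k\<close>-th power of the mean on the left and from the averaging on the right.
\<close>

lemma inverse_power_sum_le:
  fixes x :: "'b \<Rightarrow> real"
  assumes "finite J" "J \<noteq> {}" and pos: "\<And>j. j \<in> J \<Longrightarrow> 0 < x j"
  shows "1 / (\<Sum>j\<in>J. x j) ^ k \<le> (\<Sum>j\<in>J. 1 / x j ^ k) / real (card J) ^ Suc k"
proof -
  define c where "c = 1 / real (card J)"
  have card: "card J > 0" using assms by (simp add: card_gt_0_iff)
  have c: "c > 0" "(\<Sum>j\<in>J. c) = 1" using card by (auto simp: c_def)
  have S: "0 < (\<Sum>j\<in>J. x j)" using assms by (intro sum_pos) auto
  have power_convex: "convex_on {0::real..} (\<lambda>t. t ^ k)"
    using convex_power_odd convex_on_subset[OF convex_power_even] by (cases "even k") auto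
  have "convex_on {0<..} (inverse :: real \<Rightarrow> real)"
    by (rule convex_on_inverse) auto
  then have "inverse (\<Sum>j\<in>J. c *\<^sub>R x j) \<le> (\<Sum>j\<in>J. c * inverse (x j))"
    using assms(1,2) c pos by (intro convex_on_sum) (auto simp: less_imp_le)
  then have "inverse (\<Sum>j\<in>J. c *\<^sub>R x j) ^ k \<le> (\<Sum>j\<in>J. c * inverse (x j)) ^ k"
    using S c(1) by (intro power_mono) (simp_all add: sum_distrib_left[symmetric] less_imp_le)
  also have "\<dots> \<le> (\<Sum>j\<in>J. c * inverse (x j) ^ k)"
    using convex_on_sum[OF assms(1,2) power_convex c(2), of "\<lambda>j. inverse (x j)"] c(1) pos
    by (simp add: less_imp_le)
  finally have "inverse (c * (\<Sum>j\<in>J. x j)) ^ k \<le> c * (\<Sum>j\<in>J. inverse (x j) ^ k)"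
    by (simp add: sum_distrib_left)
  then have "real (card J) ^ k / (\<Sum>j\<in>J. x j) ^ k \<le> (\<Sum>j\<in>J. 1 / x j ^ k) / real (card J)"
    by (simp add: c_def power_divide power_inverse divide_simps)
  then show ?thesis
    using card S by (simp add: field_simps)
qed

text \<open>
  Restricting the denominator to the indices outside \<open>I\<close> makes it independent of the numerator. By
  \<open>inverse_power_sum_le\<close> the quotient is then dominated by an average, over \<open>j\<close> outside \<open>I\<close>, of
  products of functions of distinct variables. The inclusion of \<open>I\<close> in \<open>N\<close> has to be strict,
  for otherwise this average would be empty.
\<close>

lemma (in prob_space) expectation_prod_div_sum_squares:
  fixes u :: "'i \<Rightarrow> 'a \<Rightarrow> real"
  assumes indep: "indep_vars (\<lambda>_. borel) u N" and "finite N" "I \<subset> N" "even a"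
    and nonzero: "\<And>j. j \<in> N - I \<Longrightarrow> AE \<omega> in M. u j \<omega> \<noteq> 0"
    and int_a: "\<And>i. i \<in> I \<Longrightarrow> integrable M (\<lambda>\<omega>. u i \<omega> ^ a)"
    and exp_a: "\<And>i. i \<in> I \<Longrightarrow> expectation (\<lambda>\<omega>. u i \<omega> ^ a) = A"
    and int_k: "\<And>j. j \<in> N - I \<Longrightarrow> integrable M (\<lambda>\<omega>. 1 / u j \<omega> ^ (2 * k))"
    and exp_k: "\<And>j. j \<in> N - I \<Longrightarrow> expectation (\<lambda>\<omega>. 1 / u j \<omega> ^ (2 * k)) = B"
  shows "integrable M (\<lambda>\<omega>. (\<Prod>i\<in>I. u i \<omega> ^ a) / (\<Sum>i\<in>N. (u i \<omega>)\<^sup>2) ^ k)"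
      (is "integrable M ?F")
    and "expectation (\<lambda>\<omega>. (\<Prod>i\<in>I. u i \<omega> ^ a) / (\<Sum>i\<in>N. (u i \<omega>)\<^sup>2) ^ k)
      \<le> B * A ^ card I / real (card (N - I)) ^ k"
proof -
  define J where "J = N - I"
  have J: "finite J" "J \<noteq> {}" and I: "finite I" "I \<subseteq> N"
    using \<open>finite N\<close> \<open>I \<subset> N\<close> finite_subset by (auto simp: J_def)
  have card: "card J > 0" using J by (simp add: card_gt_0_iff)
  have meas: "u i \<in> borel_measurable M" if "i \<in> N" for i
    using indep that by (auto simp: indep_vars_def)
  define G where "G j \<omega> = (\<Prod>i\<in>I. u i \<omega> ^ a) * (1 / u j \<omega> ^ (2 * k))" for j \<omega>
  have G: "integrable M (G j)" "expectation (G j) = B * A ^ card I" if "j \<in> J" for j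
  proof -
    \<comment> \<open>\<open>G j\<close> is a product of one function of each variable, with the index \<open>j\<close> added to \<open>I\<close>.\<close>
    define Y where "Y i t = (if i = j then 1 / t ^ (2 * k) else t ^ a)" for i and t :: real
    have j: "j \<notin> I" "j \<in> N" "j \<in> N - I" using that by (auto simp: J_def)
    have ind: "indep_vars (\<lambda>_. borel) (\<lambda>i \<omega>. Y i (u i \<omega>)) (insert j I)"
    proof (rule indep_vars_compose2[of "\<lambda>_. borel" u])
      show "indep_vars (\<lambda>_. borel) u (insert j I)"
        using I j by (intro indep_vars_subset[OF indep]) auto
      show "Y i \<in> borel_measurable borel" for i
        unfolding Y_def by measurable
    qed
    have int: "integrable M (\<lambda>\<omega>. Y i (u i \<omega>))" if "i \<in> insert j I" for i
      using that int_a int_k[OF j(3)] by (cases "i = j") (auto simp: Y_def)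
    have Yj: "Y j t = 1 / t ^ (2 * k)" for t by (simp add: Y_def)
    have YI: "Y i t = t ^ a" if "i \<in> I" for i t using that j by (auto simp: Y_def)
    have eq: "(\<lambda>\<omega>. \<Prod>i\<in>insert j I. Y i (u i \<omega>)) = G j"
      using j I by (simp add: G_def fun_eq_iff Yj YI mult.commute)
    have E: "(\<Prod>i\<in>insert j I. expectation (\<lambda>\<omega>. Y i (u i \<omega>))) = B * A ^ card I"
      using j I exp_a exp_k[OF j(3)] by (simp add: Yj YI)
    show "integrable M (G j)"
      using indep_vars_integrable[OF _ ind int] I by (simp add: eq)
    show "expectation (G j) = B * A ^ card I"
      using indep_vars_lebesgue_integral[OF _ ind int] I E by (simp only: eq finite_insert)
  qed
  define R where "R \<omega> = (\<Sum>j\<in>J. G j \<omega>) / real (card J) ^ Suc k" for \<omega>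
  have R: "integrable M R"
    unfolding R_def by (intro integrable_divide Bochner_Integration.integrable_sum) (simp add: G)
  have ER: "expectation R = B * A ^ card I / real (card J) ^ k"
    unfolding R_def using card by (simp add: G Bochner_Integration.integral_sum)
  have num_nonneg: "0 \<le> (\<Prod>i\<in>I. u i \<omega> ^ a)" for \<omega>
    using \<open>even a\<close> by (intro prod_nonneg) (simp add: zero_le_even_power)
  have "AE \<omega> in M. \<forall>j\<in>J. u j \<omega> \<noteq> 0"
    using J(1) nonzero by (intro AE_finite_allI) (auto simp: J_def)
  then have le: "AE \<omega> in M. ?F \<omega> \<le> R \<omega>"
  proof (rule AE_mp, intro AE_I2 impI)
    fix \<omega> assume nz: "\<forall>j\<in>J. u j \<omega> \<noteq> 0"
    have "0 < (\<Sum>j\<in>J. (u j \<omega>)\<^sup>2)" using J nz by (intro sum_pos) auto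
    moreover have "(\<Sum>j\<in>J. (u j \<omega>)\<^sup>2) \<le> (\<Sum>j\<in>N. (u j \<omega>)\<^sup>2)"
      using \<open>finite N\<close> by (intro sum_mono2) (auto simp: J_def)
    ultimately have "?F \<omega> \<le> (\<Prod>i\<in>I. u i \<omega> ^ a) * (1 / (\<Sum>j\<in>J. (u j \<omega>)\<^sup>2) ^ k)"
      using num_nonneg[of \<omega>] by (auto intro!: divide_left_mono power_mono mult_pos_pos)
    also have "\<dots> \<le> (\<Prod>i\<in>I. u i \<omega> ^ a) *
        ((\<Sum>j\<in>J. 1 / ((u j \<omega>)\<^sup>2) ^ k) / real (card J) ^ Suc k)"
      using J nz by (intro mult_left_mono inverse_power_sum_le num_nonneg) auto
    also have "\<dots> = R \<omega>"
      by (simp add: R_def G_def sum_distrib_left power_mult sum_divide_distrib)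
    finally show "?F \<omega> \<le> R \<omega>" .
  qed
  have F_nonneg: "0 \<le> ?F \<omega>" for \<omega>
    using num_nonneg by (intro divide_nonneg_nonneg zero_le_power[OF sum_nonneg]) auto
  show int: "integrable M ?F"
  proof (rule Bochner_Integration.integrable_bound[OF R])
    show "?F \<in> borel_measurable M"
      using meas I by (intro borel_measurable_divide borel_measurable_prod borel_measurable_power
        borel_measurable_sum) auto
    show "AE \<omega> in M. norm (?F \<omega>) \<le> norm (R \<omega>)"
      using le
    proof eventually_elim
      case (elim \<omega>)
      with F_nonneg[of \<omega>] show ?case by simp
    qed
  qed
  show "expectation ?F \<le> B * A ^ card I / real (card (N - I)) ^ k"
    using integral_mono_AE[OF int R le] ER by (simp add: J_def)
qed

section \<open>Entries and norm of the Householder unistochastic matrix\<close>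

lemma frobenius_norm_square:
  "(frobenius_norm A)\<^sup>2 = (\<Sum>i<dim_row A. \<Sum>j<dim_col A. (A $$ (i, j))\<^sup>2)"
  by (simp add: frobenius_norm_def sum_mat_def sum.cartesian_product lessThan_atLeast0)
     (subst real_sqrt_pow2, auto intro!: sum_nonneg sum.cong)

text \<open>
  The formula also holds for \<open>x = 0\<close>: then both sides are entries of the identity matrix, because
  division by zero gives zero.
\<close>

lemma unistochastic_mat_one_index:
  assumes "i < dim_vec x" "j < dim_vec x"
  shows "unistochastic_mat (1\<^sub>m (dim_vec x)) x $$ (i, j) =
    ((if i = j then 1 else 0) - 2 * (x $ i * x $ j) / (\<Sum>l<dim_vec x. (x $ l)\<^sup>2))\<^sup>2"
proof -
  define v where "v = (1 / euclidean_norm_vec x) \<cdot>\<^sub>v x"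
  have v: "dim_vec v = dim_vec x" by (simp add: v_def)
  have H: "householder_mat v \<in> carrier_mat (dim_vec x) (dim_vec x)"
    by (intro carrier_matI) (simp_all add: householder_mat_def outer_prod_def v)
  have n: "euclidean_norm_vec x * euclidean_norm_vec x = (\<Sum>l<dim_vec x. (x $ l)\<^sup>2)"
    by (simp add: euclidean_norm_vec_def scalar_prod_def power2_eq_square sum_nonneg
        lessThan_atLeast0)
  have "v $ i * v $ j = x $ i * x $ j / (\<Sum>l<dim_vec x. (x $ l)\<^sup>2)"
    using assms by (simp add: v_def n)
  then have "householder_mat v $$ (i, j) =
      (if i = j then 1 else 0) - 2 * (x $ i * x $ j) / (\<Sum>l<dim_vec x. (x $ l)\<^sup>2)"
    using assms by (simp add: householder_mat_def outer_prod_def v)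
  then show ?thesis
    using assms H by (simp add: unistochastic_mat_def Let_def v_def[symmetric])
qed

lemma frobenius_norm_unistochastic_mat_minus_one:
  "(frobenius_norm (random_unistochastic_mat u n \<omega> - 1\<^sub>m n))\<^sup>2 =
    (\<Sum>i<n. \<Sum>j<n.
      (((if i = j then 1 else 0) - 2 * (u i \<omega> * u j \<omega>) / (\<Sum>l<n. (u l \<omega>)\<^sup>2))\<^sup>2
        - (if i = j then 1 else 0))\<^sup>2)"
proof -
  have entry: "(random_unistochastic_mat u n \<omega> - 1\<^sub>m n) $$ (i, j) =
      ((if i = j then 1 else 0) - 2 * (u i \<omega> * u j \<omega>) / (\<Sum>l<n. (u l \<omega>)\<^sup>2))\<^sup>2
        - (if i = j then 1 else 0)" if "i < n" "j < n" for i j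
    using that unistochastic_mat_one_index[of i "vec n (\<lambda>i. u i \<omega>)" j]
    by (simp add: random_unistochastic_mat_def)
  have dims: "dim_row (random_unistochastic_mat u n \<omega> - 1\<^sub>m n) = n"
    "dim_col (random_unistochastic_mat u n \<omega> - 1\<^sub>m n) = n"
    by simp_all
  show ?thesis
    unfolding frobenius_norm_square dims by (intro sum.cong refl) (simp only: entry lessThan_iff)
qed

text \<open>
  A diagonal entry contributes \<open>16 (p\<^sup>2 - 2p\<^sup>3 + p\<^sup>4)\<close> with \<open>p = u\<^sub>i\<^sup>2 / S\<close>, and the term
  \<open>-32 p\<^sup>3\<close> is dropped; off the diagonal there is no loss. The numerators are written as products
  over \<open>{i}\<close> and \<open>{i, j}\<close> so that \<open>expectation_prod_div_sum_squares\<close> covers all three kinds of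
  terms.
\<close>

lemma frobenius_norm_unistochastic_mat_minus_one_le:
  fixes u :: "nat \<Rightarrow> 'a \<Rightarrow> real"
  defines "S n \<omega> \<equiv> (\<Sum>l<n. (u l \<omega>)\<^sup>2)"
  shows "(frobenius_norm (random_unistochastic_mat u n \<omega> - 1\<^sub>m n))\<^sup>2 \<le>
    16 * (\<Sum>i<n. (\<Prod>l\<in>{i}. u l \<omega> ^ 8) / S n \<omega> ^ 4 + (\<Prod>l\<in>{i}. u l \<omega> ^ 4) / S n \<omega> ^ 2
      + (\<Sum>j\<in>{..<n} - {i}. (\<Prod>l\<in>{i, j}. u l \<omega> ^ 4) / S n \<omega> ^ 4))"
proof -
  let ?d = "\<lambda>i j. (if i = j then 1 else 0 :: real)"
  let ?t = "\<lambda>i j. ((?d i j - 2 * (u i \<omega> * u j \<omega>) / S n \<omega>)\<^sup>2 - ?d i j)\<^sup>2"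
  have S: "0 \<le> S n \<omega>" by (simp add: S_def sum_nonneg)
  have diag: "?t i i \<le> 16 * (u i \<omega> ^ 8 / S n \<omega> ^ 4 + u i \<omega> ^ 4 / S n \<omega> ^ 2)" for i
  proof -
    define p where "p = (u i \<omega>)\<^sup>2 / S n \<omega>"
    have "0 \<le> p" using S by (simp add: p_def)
    have "?t i i = ((1 - 2 * p)\<^sup>2 - 1)\<^sup>2"
      by (simp add: p_def power2_eq_square)
    also have "\<dots> = 16 * (p ^ 4 + p\<^sup>2) - 32 * p ^ 3"
      by (simp add: eval_nat_numeral algebra_simps)
    also have "\<dots> \<le> 16 * (p ^ 4 + p\<^sup>2)"
      using \<open>0 \<le> p\<close> by simp
    finally show ?thesis
      by (simp add: p_def power_divide power_mult[symmetric])
  qed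
  have off: "?t i j = 16 * ((\<Prod>l\<in>{i, j}. u l \<omega> ^ 4) / S n \<omega> ^ 4)" if "j \<noteq> i" for i j
    using that by (simp add: power_divide power_mult_distrib power_mult[symmetric])
  have "(\<Sum>j<n. ?t i j) \<le> 16 * ((\<Prod>l\<in>{i}. u l \<omega> ^ 8) / S n \<omega> ^ 4
      + (\<Prod>l\<in>{i}. u l \<omega> ^ 4) / S n \<omega> ^ 2
      + (\<Sum>j\<in>{..<n} - {i}. (\<Prod>l\<in>{i, j}. u l \<omega> ^ 4) / S n \<omega> ^ 4))" if "i < n" for i
  proof -
    have "(\<Sum>j<n. ?t i j) = ?t i i + (\<Sum>j\<in>{..<n} - {i}. ?t i j)"
      using that by (intro sum.remove) auto
    also have "(\<Sum>j\<in>{..<n} - {i}. ?t i j) =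
        16 * (\<Sum>j\<in>{..<n} - {i}. (\<Prod>l\<in>{i, j}. u l \<omega> ^ 4) / S n \<omega> ^ 4)"
      unfolding sum_distrib_left by (intro sum.cong refl off) auto
    finally show ?thesis using diag[of i] by simp
  qed
  then show ?thesis
    unfolding frobenius_norm_unistochastic_mat_minus_one S_def[symmetric] sum_distrib_left
    by (intro sum_mono) (auto simp: sum_distrib_left)
qed

section \<open>Convergence to the identity matrix\<close>

theorem proposition7p1:
  fixes P :: "'a measure" and u :: "nat \<Rightarrow> 'a \<Rightarrow> real"
  assumes "prob_space P"
    and "prob_space.indep_vars P (\<lambda>_. borel) u UNIV"
    and "\<And>i j. distr P borel (u i) = distr P borel (u j)"
    and "\<And>i. AE \<omega> in P. u i \<omega> \<noteq> 0"
    and "\<And>i. integrable P (\<lambda>\<omega>. u i \<omega> ^ 4)"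
    and "\<And>i. integrable P (\<lambda>\<omega>. u i \<omega> ^ 8)"
    and "\<And>i. integrable P (\<lambda>\<omega>. 1 / u i \<omega> ^ 4)"
    and "\<And>i. integrable P (\<lambda>\<omega>. 1 / u i \<omega> ^ 8)"
  defines "M \<equiv> random_unistochastic_mat u"
  shows "(\<forall>n\<ge>3. integrable P (\<lambda>\<omega>. frobenius_norm (M n \<omega> - 1\<^sub>m n)) \<and>
            integrable P (\<lambda>\<omega>. (frobenius_norm (M n \<omega> - 1\<^sub>m n))\<^sup>2)) \<and>
    (\<lambda>n. \<integral>\<omega>. frobenius_norm (M n \<omega> - 1\<^sub>m n) \<partial>P) \<longlonglongrightarrow> 0 \<and>
    (\<forall>n\<ge>3. \<forall>i.
      (\<integral>\<omega>. (frobenius_norm (M n \<omega> - 1\<^sub>m n))\<^sup>2 \<partial>P)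
        \<le> 16 * real n / (real n - 1) ^ 4
            * (\<integral>\<omega>. 1 / u i \<omega> ^ 8 \<partial>P) * (\<integral>\<omega>. u i \<omega> ^ 8 \<partial>P)
          + 16 * real n / (real n - 1)\<^sup>2
            * (\<integral>\<omega>. 1 / u i \<omega> ^ 4 \<partial>P) * (\<integral>\<omega>. u i \<omega> ^ 4 \<partial>P)
          + 16 * real n * (real n - 1) / (real n - 2) ^ 4
            * (\<integral>\<omega>. 1 / u i \<omega> ^ 8 \<partial>P) * (\<integral>\<omega>. u i \<omega> ^ 4 \<partial>P)\<^sup>2)"
proof -
  interpret prob_space P by fact
  have meas [measurable]: "u i \<in> borel_measurable P" for i
    using assms(2) by (auto simp: indep_vars_def)
  have moment: "expectation (\<lambda>\<omega>. f (u i \<omega>)) = expectation (\<lambda>\<omega>. f (u 0 \<omega>))"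
    if "f \<in> borel_measurable borel" for i and f :: "real \<Rightarrow> real"
    using integral_distr[OF meas that, of i] integral_distr[OF meas that, of 0] assms(3)[of i 0]
    by simp
  define a4 where "a4 = expectation (\<lambda>\<omega>. u 0 \<omega> ^ 4)"
  define a8 where "a8 = expectation (\<lambda>\<omega>. u 0 \<omega> ^ 8)"
  define b4 where "b4 = expectation (\<lambda>\<omega>. 1 / u 0 \<omega> ^ 4)"
  define b8 where "b8 = expectation (\<lambda>\<omega>. 1 / u 0 \<omega> ^ 8)"
  have E: "expectation (\<lambda>\<omega>. u i \<omega> ^ 4) = a4" "expectation (\<lambda>\<omega>. u i \<omega> ^ 8) = a8"
    "expectation (\<lambda>\<omega>. 1 / u i \<omega> ^ 4) = b4" "expectation (\<lambda>\<omega>. 1 / u i \<omega> ^ 8) = b8" for i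
    unfolding a4_def a8_def b4_def b8_def
    using moment[of "\<lambda>t. t ^ 4" i] moment[of "\<lambda>t. t ^ 8" i]
      moment[of "\<lambda>t. 1 / t ^ 4" i] moment[of "\<lambda>t. 1 / t ^ 8" i] by auto
  define X where "X n \<omega> = frobenius_norm (M n \<omega> - 1\<^sub>m n)" for n \<omega>
  define bound where "bound n = 16 * real n / (real n - 1) ^ 4 * b8 * a8
      + 16 * real n / (real n - 1)\<^sup>2 * b4 * a4
      + 16 * real n * (real n - 1) / (real n - 2) ^ 4 * b8 * a4\<^sup>2" for n
  have X_nonneg: "0 \<le> X n \<omega>" for n \<omega>
    by (auto simp: X_def frobenius_norm_def sum_mat_def intro!: sum_nonneg)
  have X_square_meas: "(\<lambda>\<omega>. (X n \<omega>)\<^sup>2) \<in> borel_measurable P" for n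
    unfolding X_def M_def frobenius_norm_unistochastic_mat_minus_one by measurable
  \<comment> \<open>The norm is recovered from its square, which is an explicit function of the \<open>u i\<close>.\<close>
  have "(\<lambda>\<omega>. sqrt ((X n \<omega>)\<^sup>2)) \<in> borel_measurable P" for n
    using X_square_meas by measurable
  then have X_meas: "X n \<in> borel_measurable P" for n
    using X_nonneg by simp
  have second_moment: "integrable P (\<lambda>\<omega>. (X n \<omega>)\<^sup>2) \<and> expectation (\<lambda>\<omega>. (X n \<omega>)\<^sup>2) \<le> bound n"
    if n: "n \<ge> 3" for n
  proof -
    define S where "S \<omega> = (\<Sum>l<n. (u l \<omega>)\<^sup>2)" for \<omega>
    have indep: "indep_vars (\<lambda>_. borel) u {..<n}"
      using indep_vars_subset[OF assms(2)] by simp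
    note ratio = expectation_prod_div_sum_squares[OF indep, folded S_def]
    have one: "{i} \<subset> {..<n}" "card ({..<n} - {i}) = n - 1" if "i < n" for i
    proof -
      show c: "card ({..<n} - {i}) = n - 1" using that by simp
      have "{i} \<noteq> {..<n}" using c n by (intro notI) simp
      then show "{i} \<subset> {..<n}" using that by blast
    qed
    have two: "{i, j} \<subset> {..<n}" "card ({..<n} - {i, j}) = n - 2"
      if "i < n" "j \<in> {..<n} - {i}" for i j
    proof -
      show c: "card ({..<n} - {i, j}) = n - 2"
        using that by (subst card_Diff_subset) auto
      have "{i, j} \<noteq> {..<n}" using c n by (intro notI) simp
      then show "{i, j} \<subset> {..<n}" using that by blast
    qed
    define F where "F i \<omega> = (\<Prod>l\<in>{i}. u l \<omega> ^ 8) / S \<omega> ^ 4" for i \<omega>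
    define G where "G i \<omega> = (\<Prod>l\<in>{i}. u l \<omega> ^ 4) / S \<omega> ^ 2" for i \<omega>
    define K where "K i j \<omega> = (\<Prod>l\<in>{i, j}. u l \<omega> ^ 4) / S \<omega> ^ 4" for i j \<omega>
    have F: "integrable P (F i)" "expectation (F i) \<le> b8 * a8 / (real n - 1) ^ 4"
      if "i < n" for i
      using ratio[OF _ one(1)[OF that], of 8 a8 4 b8] that n assms(4-8) E one(2)[OF that]
      unfolding F_def by (auto simp: of_nat_diff)
    have G: "integrable P (G i)" "expectation (G i) \<le> b4 * a4 / (real n - 1)\<^sup>2"
      if "i < n" for i
      using ratio[OF _ one(1)[OF that], of 4 a4 2 b4] that n assms(4-8) E one(2)[OF that]
      unfolding G_def by (auto simp: of_nat_diff)
    have K: "integrable P (K i j)" "expectation (K i j) \<le> b8 * a4\<^sup>2 / (real n - 2) ^ 4"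
      if "i < n" "j \<in> {..<n} - {i}" for i j
      using ratio[OF _ two(1)[OF that], of 4 a4 4 b8] that n assms(4-8) E two(2)[OF that]
      unfolding K_def by (auto simp: of_nat_diff power2_eq_square)
    define T where "T i \<omega> = F i \<omega> + G i \<omega> + (\<Sum>j\<in>{..<n} - {i}. K i j \<omega>)" for i \<omega>
    have T: "integrable P (T i)" "expectation (T i) =
        expectation (F i) + expectation (G i) + (\<Sum>j\<in>{..<n} - {i}. expectation (K i j))"
      if "i < n" for i
    proof -
      have sum_K: "integrable P (\<lambda>\<omega>. \<Sum>j\<in>{..<n} - {i}. K i j \<omega>)"
        using K(1)[OF that] by (rule Bochner_Integration.integrable_sum)
      show "integrable P (T i)"
        unfolding T_def using F(1) G(1) sum_K that by (intro Bochner_Integration.integrable_add)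
      show "expectation (T i) =
          expectation (F i) + expectation (G i) + (\<Sum>j\<in>{..<n} - {i}. expectation (K i j))"
        unfolding T_def using F(1) G(1) sum_K K(1)[OF that] that
        by (subst Bochner_Integration.integral_add Bochner_Integration.integral_sum, simp, simp)+
    qed
    define R where "R \<omega> = 16 * (\<Sum>i<n. T i \<omega>)" for \<omega>
    have le: "(X n \<omega>)\<^sup>2 \<le> R \<omega>" for \<omega>
      using frobenius_norm_unistochastic_mat_minus_one_le[of u n \<omega>]
      unfolding X_def M_def R_def T_def F_def G_def K_def S_def .
    have R: "integrable P R"
      unfolding R_def
      by (intro integrable_mult_right Bochner_Integration.integrable_sum) (simp add: T)
    have int: "integrable P (\<lambda>\<omega>. (X n \<omega>)\<^sup>2)"
    proof (rule Bochner_Integration.integrable_bound[OF R X_square_meas], intro AE_I2)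
      fix \<omega>
      have "0 \<le> (X n \<omega>)\<^sup>2" by simp
      with le[of \<omega>] show "norm ((X n \<omega>)\<^sup>2) \<le> norm (R \<omega>)"
        unfolding real_norm_def by linarith
    qed
    have "expectation (\<lambda>\<omega>. (X n \<omega>)\<^sup>2) \<le> expectation R"
      using int R le by (intro integral_mono)
    also have "expectation R = 16 * (\<Sum>i<n. expectation (F i) + expectation (G i)
        + (\<Sum>j\<in>{..<n} - {i}. expectation (K i j)))"
      unfolding R_def using T by (simp add: Bochner_Integration.integral_sum)
    also have "\<dots> \<le> 16 * (\<Sum>i<n. b8 * a8 / (real n - 1) ^ 4 + b4 * a4 / (real n - 1)\<^sup>2
        + (\<Sum>j\<in>{..<n} - {i}. b8 * a4\<^sup>2 / (real n - 2) ^ 4))"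
      by (intro mult_left_mono sum_mono add_mono F G K) auto
    also have "\<dots> = bound n"
      using n by (simp add: bound_def of_nat_diff distrib_left mult_ac)
    finally show ?thesis using int by simp
  qed
  have first_moment: "integrable P (X n)" "expectation (X n) \<le> sqrt (bound n)" if "n \<ge> 3" for n
  proof -
    note sq = second_moment[OF that]
    show int: "integrable P (X n)"
      using square_integrable_imp_integrable[OF X_meas] sq by blast
    \<comment> \<open>The variance is nonnegative.\<close>
    have "(expectation (X n))\<^sup>2 \<le> expectation (\<lambda>\<omega>. (X n \<omega>)\<^sup>2)"
      using variance_positive[of "X n"] variance_eq[OF int] sq by simp
    also have "\<dots> \<le> bound n" using sq by simp
    finally show "expectation (X n) \<le> sqrt (bound n)" by (rule real_le_rsqrt)
  qed
  have "(\<lambda>n. 16 * real n / (real n - 1) ^ 4) \<longlonglongrightarrow> 0"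
    "(\<lambda>n. 16 * real n / (real n - 1)\<^sup>2) \<longlonglongrightarrow> 0"
    "(\<lambda>n. 16 * real n * (real n - 1) / (real n - 2) ^ 4) \<longlonglongrightarrow> 0"
    by real_asymp+
  then have "bound \<longlonglongrightarrow> 0"
    unfolding bound_def by (intro tendsto_add_zero tendsto_mult_left_zero)
  then have sqrt_bound: "(\<lambda>n. sqrt (bound n)) \<longlonglongrightarrow> 0"
    using tendsto_real_sqrt by fastforce
  have "(\<lambda>n. expectation (X n)) \<longlonglongrightarrow> 0"
  proof (rule tendsto_sandwich[OF _ _ tendsto_const sqrt_bound])
    show "\<forall>\<^sub>F n in sequentially. 0 \<le> expectation (X n)"
      using X_nonneg by simp
    show "\<forall>\<^sub>F n in sequentially. expectation (X n) \<le> sqrt (bound n)"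
      using first_moment(2) eventually_at_top_linorder by blast
  qed
  then show ?thesis
    using first_moment(1) second_moment
    unfolding E bound_def X_def by blast
qed

end
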